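(* Let $X$ be a chain, let $S\in\{\mathcal{PO}(X),\mathcal{POP}(X),\mathcal{POI}(X),\mathcal{POPI}(X)\}$ and let $\alpha,\beta\in S$. Then, in $S$: (1) $\alpha\,\mathcal{L}\,\beta$ if and only if $\mathrm{Im}(\alpha)=\mathrm{Im}(\beta)$; (2) $\alpha\,\mathcal{R}\,\beta$ if and only if $\ker(\alpha)=\ker(\beta)$; (3) $\alpha\,\mathcal{H}\,\beta$ if and only if $\mathrm{Im}(\alpha)=\mathrm{Im}(\beta)$ and $\ker(\alpha)=\ker(\beta)$.
   Context: $X$ is a chain (totally ordered set), finite or infinite. $\mathcal{PT}(X)$ is the monoid of all partial transformations of $X$ (including the empty one) under composition of partial maps, written on the right: $x(\alpha\beta)=(x\alpha)\beta$, with $\mathrm{Dom}(\alpha\beta)=\{x\in\mathrm{Dom}(\alpha)\mid x\alpha\in\mathrm{Dom}(\beta)\}$. $\alpha\in\mathcal{PT}(X)$ is order-preserving on $Y\subseteq\mathrm{Dom}(\alpha)$ if $x\le y$ implies $x\alpha\le y\alpha$ for all $x,y\in Y$, and order-preserving if it is so on $\mathrm{Dom}(\alpha)$. $\alpha\in\mathcal{PT}(X)$ is orientation-preserving if it is the empty transformation or there exists a non-empty subset $Y$ of $\mathrm{Dom}(\alpha)$ such that: (OP1) $\alpha$ is order-preserving both on $Y$ and on $\mathrm{Dom}(\alpha)\setminus Y$; (OP2) for all $a\in Y$ and $b\in\mathrm{Dom}(\alpha)\setminus Y$, $a\le b$ and $a\alpha\ge b\alpha$. $\mathcal{PO}(X)$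 and $\mathcal{POP}(X)$ are the submonoids of $\mathcal{PT}(X)$ of all order-preserving, respectively orientation-preserving, partial transformations; $\mathcal{POI}(X)$ and $\mathcal{POPI}(X)$ are their respective submonoids of injective elements. $\ker(\alpha)=\{(x,y)\in\mathrm{Dom}(\alpha)\times\mathrm{Dom}(\alpha)\mid x\alpha=y\alpha\}$. Green's relations on a monoid $S$: $\alpha\,\mathcal{L}\,\beta$ iff $S\alpha=S\beta$; $\alpha\,\mathcal{R}\,\beta$ iff $\alpha S=\beta S$; $\mathcal{H}=\mathcal{L}\cap\mathcal{R}$. *)

theory Defs
  imports "HOL-Algebra.Coset"
begin

text \<open>
  A chain is a subset \<open>X\<close> of a type of class \<open>linorder\<close> with the induced order, so the empty
  chain is included. A partial transformation of \<open>X\<close> is a map whose domain and range lie in \<open>X\<close>.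
  Partial maps act on the right: \<open>pcomp \<alpha> \<beta>\<close> applies \<open>\<alpha>\<close> first.
\<close>

definition pcomp :: "('a \<rightharpoonup> 'a) \<Rightarrow> ('a \<rightharpoonup> 'a) \<Rightarrow> ('a \<rightharpoonup> 'a)" where
  "pcomp \<alpha> \<beta> = \<beta> \<circ>\<^sub>m \<alpha>"

definition PT :: "'a set \<Rightarrow> ('a \<rightharpoonup> 'a) monoid" where
  "PT X = \<lparr>carrier = {\<alpha>. dom \<alpha> \<subseteq> X \<and> ran \<alpha> \<subseteq> X}, mult = pcomp, one = Some |` X\<rparr>"

definition order_preserving_on :: "'a::linorder set \<Rightarrow> ('a \<rightharpoonup> 'a) \<Rightarrow> bool" where
  "order_preserving_on Y \<alpha> \<longleftrightarrow> Y \<subseteq> dom \<alpha> \<and> mono_on Y (\<lambda>x. the (\<alpha> x))"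

definition order_preserving :: "('a::linorder \<rightharpoonup> 'a) \<Rightarrow> bool" where
  "order_preserving \<alpha> \<longleftrightarrow> order_preserving_on (dom \<alpha>) \<alpha>"

definition orientation_preserving :: "('a::linorder \<rightharpoonup> 'a) \<Rightarrow> bool" where
  "orientation_preserving \<alpha> \<longleftrightarrow> \<alpha> = Map.empty \<or>
    (\<exists>Y. Y \<noteq> {} \<and> Y \<subseteq> dom \<alpha> \<and>
      order_preserving_on Y \<alpha> \<and> order_preserving_on (dom \<alpha> - Y) \<alpha> \<and>
      (\<forall>a\<in>Y. \<forall>b\<in>dom \<alpha> - Y. a \<le> b \<and> the (\<alpha> a) \<ge> the (\<alpha> b)))"

definition injective :: "('a \<rightharpoonup> 'a) \<Rightarrow> bool" where
  "injective \<alpha> \<longleftrightarrow> inj_on \<alpha> (dom \<alpha>)"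

definition PO :: "'a::linorder set \<Rightarrow> ('a \<rightharpoonup> 'a) monoid" where
  "PO X = (PT X)\<lparr>carrier := {\<alpha> \<in> carrier (PT X). order_preserving \<alpha>}\<rparr>"

definition POP :: "'a::linorder set \<Rightarrow> ('a \<rightharpoonup> 'a) monoid" where
  "POP X = (PT X)\<lparr>carrier := {\<alpha> \<in> carrier (PT X). orientation_preserving \<alpha>}\<rparr>"

definition POI :: "'a::linorder set \<Rightarrow> ('a \<rightharpoonup> 'a) monoid" where
  "POI X = (PO X)\<lparr>carrier := {\<alpha> \<in> carrier (PO X). injective \<alpha>}\<rparr>"

definition POPI :: "'a::linorder set \<Rightarrow> ('a \<rightharpoonup> 'a) monoid" where
  "POPI X = (POP X)\<lparr>carrier := {\<alpha> \<in> carrier (POP X). injective \<alpha>}\<rparr>"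

definition ker :: "('a \<rightharpoonup> 'a) \<Rightarrow> ('a \<times> 'a) set" where
  "ker \<alpha> = {(x, y) \<in> dom \<alpha> \<times> dom \<alpha>. \<alpha> x = \<alpha> y}"

definition green_L :: "('a, 'b) monoid_scheme \<Rightarrow> ('a \<times> 'a) set" where
  "green_L S = {(a, b) \<in> carrier S \<times> carrier S. carrier S #>\<^bsub>S\<^esub> a = carrier S #>\<^bsub>S\<^esub> b}"

definition green_R :: "('a, 'b) monoid_scheme \<Rightarrow> ('a \<times> 'a) set" where
  "green_R S = {(a, b) \<in> carrier S \<times> carrier S. a <#\<^bsub>S\<^esub> carrier S = b <#\<^bsub>S\<^esub> carrier S}"

definition green_H :: "('a, 'b) monoid_scheme \<Rightarrow> ('a \<times> 'a) set" where
  "green_H S = green_L S \<inter> green_R S"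

end

theory Submission imports Defs begin

text \<open>
  All four monoids \<open>S\<close> are regular submonoids of \<open>PT X\<close>, and in a strong sense: a section of
  \<open>\<beta> \<in> S\<close>, that is, a partial map \<open>\<sigma>\<close> choosing one preimage under \<open>\<beta>\<close> for each point of
  \<open>ran \<beta>\<close>, lies in \<open>S\<close> however the preimages are chosen. If \<open>\<beta>\<close> preserves order, so does \<open>\<sigma>\<close>;
  if \<open>\<beta>\<close> consists of two increasing pieces, the earlier one with the larger values, then \<open>\<sigma>\<close>
  consists of two increasing pieces as well, with the roles of the pieces exchanged
  (lemmas \<open>order_preserving_section\<close> and \<open>orientation_preserving_section\<close>); and a section is
  always injective.

  Sections produce the multipliers that Green's relations ask for. If \<open>\<alpha>\<close> and \<open>\<beta>\<close> have the same
  image, then \<open>\<alpha> = (\<alpha>\<sigma>)\<beta>\<close>, because \<open>\<sigma>\<beta>\<close> is the identity on \<open>ran \<beta>\<close>. If they have the same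
  kernel, then \<open>\<alpha> = \<beta>(\<sigma>\<alpha>)\<close>, because \<open>\<beta>\<sigma>\<close> moves every point inside its kernel class. Since
  \<open>S\<close> is closed under composition, \<open>\<alpha>\<sigma>\<close> and \<open>\<sigma>\<alpha>\<close> belong to \<open>S\<close>; the order enters only
  through this closure and through the sections. Closure has content only in the
  orientation-preserving case (lemma \<open>orientation_preserving_pcomp\<close>), where the two pieces of
  \<open>\<alpha>\<close> and the two pieces of \<open>\<beta>\<close> must combine to no more than two.
\<close>

lemma pcomp_eq_Some_iff: "pcomp \<alpha> \<beta> x = Some z \<longleftrightarrow> (\<exists>y. \<alpha> x = Some y \<and> \<beta> y = Some z)"
  by (simp add: pcomp_def map_comp_Some_iff)

lemma pcomp_assoc: "pcomp (pcomp \<alpha> \<beta>) \<gamma> = pcomp \<alpha> (pcomp \<beta> \<gamma>)"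
  by (rule ext) (simp add: pcomp_def map_comp_def split: option.split)

lemma ran_pcomp_subset: "ran (pcomp \<alpha> \<beta>) \<subseteq> ran \<beta>"
  by (auto simp: ran_def pcomp_eq_Some_iff)

lemma dom_pcomp_subset: "dom (pcomp \<alpha> \<beta>) \<subseteq> dom \<alpha>"
  by (auto simp: dom_def pcomp_eq_Some_iff)

lemma dom_eq_if_ker_eq: "ker \<alpha> = ker \<beta> \<Longrightarrow> dom \<alpha> = dom \<beta>"
  unfolding ker_def by blast


section \<open>Sections of partial maps\<close>

definition is_section :: "('a \<rightharpoonup> 'a) \<Rightarrow> ('a \<rightharpoonup> 'a) \<Rightarrow> bool" where
  "is_section \<sigma> \<beta> \<longleftrightarrow> dom \<sigma> = ran \<beta> \<and> (\<forall>y x. \<sigma> y = Some x \<longrightarrow> \<beta> x = Some y)"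

lemma ex_section: "\<exists>\<sigma>. is_section \<sigma> \<beta>"
proof
  let ?\<sigma> = "\<lambda>y. if y \<in> ran \<beta> then Some (SOME x. \<beta> x = Some y) else None"
  have "\<beta> (SOME x. \<beta> x = Some y) = Some y" if "y \<in> ran \<beta>" for y
    using that unfolding ran_def by (auto intro: someI)
  then show "is_section ?\<sigma> \<beta>"
    by (auto simp: is_section_def dom_def split: if_splits)
qed

lemma section_in_PT:
  assumes "is_section \<sigma> \<beta>" "\<beta> \<in> carrier (PT X)"
  shows "\<sigma> \<in> carrier (PT X)"
  using assms by (auto simp: is_section_def PT_def ran_def dom_def)

lemma injective_section:
  assumes "is_section \<sigma> \<beta>"
  shows "injective \<sigma>"
  unfolding injective_def
proof (rule inj_onI)
  fix y y' assume "y \<in> dom \<sigma>" and eq: "\<sigma> y = \<sigma> y'"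
  then obtain x where "\<sigma> y = Some x" by blast
  moreover from this eq have "\<sigma> y' = Some x" by simp
  ultimately have "\<beta> x = Some y" "\<beta> x = Some y'" using assms unfolding is_section_def by blast+
  then show "y = y'" by simp
qed

lemma left_factor_by_section:
  assumes "is_section \<sigma> \<beta>" "ran \<alpha> \<subseteq> ran \<beta>"
  shows "pcomp (pcomp \<alpha> \<sigma>) \<beta> = \<alpha>"
proof -
  have "pcomp (pcomp \<alpha> \<sigma>) \<beta> x = \<alpha> x" for x
  proof (cases "\<alpha> x")
    case (Some y)
    then have "y \<in> dom \<sigma>" using assms by (auto simp: is_section_def intro: ranI)
    then obtain x' where "\<sigma> y = Some x'" by blast
    with Some assms(1) show ?thesis by (auto simp: is_section_def pcomp_def)
  qed (simp add: pcomp_def)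
  then show ?thesis by blast
qed

lemma right_factor_by_section:
  assumes "is_section \<sigma> \<beta>" "ker \<alpha> = ker \<beta>"
  shows "pcomp \<beta> (pcomp \<sigma> \<alpha>) = \<alpha>"
proof -
  have "pcomp \<beta> (pcomp \<sigma> \<alpha>) x = \<alpha> x" for x
  proof (cases "\<beta> x")
    case None
    then have "\<alpha> x = None" using dom_eq_if_ker_eq[OF assms(2)] by blast
    with None show ?thesis by (simp add: pcomp_def)
  next
    case (Some y)
    then have "y \<in> dom \<sigma>" using assms by (auto simp: is_section_def intro: ranI)
    then obtain x' where x': "\<sigma> y = Some x'" by blast
    with assms(1) have "\<beta> x' = Some y" by (simp add: is_section_def)
    with Some have "(x, x') \<in> ker \<beta>" by (auto simp: ker_def)
    then have "\<alpha> x = \<alpha> x'" unfolding assms(2)[symmetric] by (simp add: ker_def)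
    with Some x' show ?thesis by (simp add: pcomp_def)
  qed
  then show ?thesis by blast
qed


section \<open>Green's relations in submonoids closed under sections\<close>

definition has_sections :: "'a set \<Rightarrow> ('a \<rightharpoonup> 'a) monoid \<Rightarrow> bool" where
  "has_sections X S \<longleftrightarrow> mult S = pcomp \<and> carrier S \<subseteq> carrier (PT X) \<and> Some |` X \<in> carrier S \<and>
    (\<forall>\<alpha>\<in>carrier S. \<forall>\<beta>\<in>carrier S. pcomp \<alpha> \<beta> \<in> carrier S) \<and>
    (\<forall>\<beta>\<in>carrier S. \<forall>\<sigma>. is_section \<sigma> \<beta> \<longrightarrow> \<sigma> \<in> carrier S)"

lemma pcomp_id_left:
  assumes "\<alpha> \<in> carrier (PT X)"
  shows "pcomp (Some |` X) \<alpha> = \<alpha>"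
proof
  fix x show "pcomp (Some |` X) \<alpha> x = \<alpha> x"
    using assms by (cases "\<alpha> x") (auto simp: PT_def pcomp_def restrict_map_def dom_def map_comp_def)
qed

lemma pcomp_id_right:
  assumes "\<alpha> \<in> carrier (PT X)"
  shows "pcomp \<alpha> (Some |` X) = \<alpha>"
proof
  fix x show "pcomp \<alpha> (Some |` X) x = \<alpha> x"
    using assms by (cases "\<alpha> x") (auto simp: PT_def pcomp_def restrict_map_def ran_def)
qed

text \<open>
  Each relation is first reduced to divisibility: equal one-sided ideals contain each other's
  generators because \<open>S\<close> has an identity, and the converse is associativity.
\<close>

lemma green_L_iff_ran_eq:
  assumes S: "has_sections X S" and a: "\<alpha> \<in> carrier S" and b: "\<beta> \<in> carrier S"
  shows "(\<alpha>, \<beta>) \<in> green_L S \<longleftrightarrow> ran \<alpha> = ran \<beta>"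
proof -
  define ideal where "ideal \<delta> = {pcomp \<gamma> \<delta> | \<gamma>. \<gamma> \<in> carrier S}" for \<delta>
  have green: "(\<alpha>, \<beta>) \<in> green_L S \<longleftrightarrow> ideal \<alpha> = ideal \<beta>"
  proof -
    have "carrier S #>\<^bsub>S\<^esub> \<delta> = ideal \<delta>" for \<delta>
      using S by (auto simp: r_coset_def has_sections_def ideal_def)
    with a b show ?thesis by (simp add: green_L_def)
  qed
  have gen: "\<delta> \<in> ideal \<delta>" if "\<delta> \<in> carrier S" for \<delta>
  proof -
    have "\<delta> \<in> carrier (PT X)" "Some |` X \<in> carrier S"
      using S that unfolding has_sections_def by blast+
    then show ?thesis unfolding ideal_def using pcomp_id_left[of \<delta> X, symmetric] by blast
  qed
  have ran: "ran \<delta> \<subseteq> ran \<epsilon>" if "\<delta> \<in> ideal \<epsilon>" for \<delta> \<epsilon>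
  proof -
    obtain \<gamma> where "\<delta> = pcomp \<gamma> \<epsilon>" using \<open>\<delta> \<in> ideal \<epsilon>\<close> by (auto simp: ideal_def)
    then show ?thesis by (simp add: ran_pcomp_subset)
  qed
  have sub: "ideal \<delta> \<subseteq> ideal \<epsilon>"
    if d: "\<delta> \<in> carrier S" "\<epsilon> \<in> carrier S" "ran \<delta> \<subseteq> ran \<epsilon>" for \<delta> \<epsilon>
  proof
    fix \<gamma> assume "\<gamma> \<in> ideal \<delta>"
    then obtain \<rho> where \<rho>: "\<rho> \<in> carrier S" "\<gamma> = pcomp \<rho> \<delta>" by (auto simp: ideal_def)
    obtain \<sigma> where \<sigma>: "is_section \<sigma> \<epsilon>" using ex_section by blast
    have "\<gamma> = pcomp (pcomp \<rho> (pcomp \<delta> \<sigma>)) \<epsilon>"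
      using \<rho> left_factor_by_section[OF \<sigma> d(3)] by (simp add: pcomp_assoc)
    moreover have "pcomp \<rho> (pcomp \<delta> \<sigma>) \<in> carrier S"
      using S \<sigma> \<rho> d by (simp add: has_sections_def)
    ultimately show "\<gamma> \<in> ideal \<epsilon>" by (auto simp: ideal_def)
  qed
  show ?thesis unfolding green
    using gen[OF a] gen[OF b] ran sub[OF a b] sub[OF b a] by (metis subset_antisym subset_refl)
qed

lemma green_R_iff_ker_eq:
  assumes S: "has_sections X S" and a: "\<alpha> \<in> carrier S" and b: "\<beta> \<in> carrier S"
  shows "(\<alpha>, \<beta>) \<in> green_R S \<longleftrightarrow> ker \<alpha> = ker \<beta>"
proof -
  define ideal where "ideal \<delta> = {pcomp \<delta> \<gamma> | \<gamma>. \<gamma> \<in> carrier S}" for \<delta>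
  have green: "(\<alpha>, \<beta>) \<in> green_R S \<longleftrightarrow> ideal \<alpha> = ideal \<beta>"
  proof -
    have "\<delta> <#\<^bsub>S\<^esub> carrier S = ideal \<delta>" for \<delta>
      using S by (auto simp: l_coset_def has_sections_def ideal_def)
    with a b show ?thesis by (simp add: green_R_def)
  qed
  have gen: "\<delta> \<in> ideal \<delta>" if "\<delta> \<in> carrier S" for \<delta>
  proof -
    have "\<delta> \<in> carrier (PT X)" "Some |` X \<in> carrier S"
      using S that unfolding has_sections_def by blast+
    then show ?thesis unfolding ideal_def using pcomp_id_right[of \<delta> X, symmetric] by blast
  qed
  have sub: "ideal \<delta> \<subseteq> ideal \<epsilon>"
    if d: "\<delta> \<in> carrier S" "\<epsilon> \<in> carrier S" "ker \<delta> = ker \<epsilon>" for \<delta> \<epsilon>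
  proof
    fix \<gamma> assume "\<gamma> \<in> ideal \<delta>"
    then obtain \<rho> where \<rho>: "\<rho> \<in> carrier S" "\<gamma> = pcomp \<delta> \<rho>" by (auto simp: ideal_def)
    obtain \<sigma> where \<sigma>: "is_section \<sigma> \<epsilon>" using ex_section by blast
    have "\<gamma> = pcomp \<epsilon> (pcomp (pcomp \<sigma> \<delta>) \<rho>)"
      using \<rho> right_factor_by_section[OF \<sigma> d(3)] by (metis pcomp_assoc)
    moreover have "pcomp (pcomp \<sigma> \<delta>) \<rho> \<in> carrier S"
      using S \<sigma> \<rho> d by (simp add: has_sections_def)
    ultimately show "\<gamma> \<in> ideal \<epsilon>" by (auto simp: ideal_def)
  qed
  have dom: "dom \<delta> \<subseteq> dom \<epsilon>" if "\<delta> \<in> ideal \<epsilon>" for \<delta> \<epsilon>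
  proof -
    obtain \<gamma> where "\<delta> = pcomp \<epsilon> \<gamma>" using \<open>\<delta> \<in> ideal \<epsilon>\<close> by (auto simp: ideal_def)
    then show ?thesis by (simp add: dom_pcomp_subset)
  qed
  \<comment> \<open>One divisibility alone does not compare kernels, since a right multiplier may shrink the
     domain; divisibility in both directions makes the domains equal.\<close>
  have ker: "ker \<epsilon> \<subseteq> ker \<delta>" if "\<delta> \<in> ideal \<epsilon>" "\<epsilon> \<in> ideal \<delta>" for \<delta> \<epsilon>
  proof -
    obtain \<gamma> where "\<delta> = pcomp \<epsilon> \<gamma>" using \<open>\<delta> \<in> ideal \<epsilon>\<close> by (auto simp: ideal_def)
    moreover have "dom \<epsilon> = dom \<delta>" using dom that by blast
    ultimately show ?thesis by (auto simp: ker_def pcomp_def map_comp_def)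
  qed
  show ?thesis unfolding green
    using gen[OF a] gen[OF b] ker[of \<alpha> \<beta>] ker[of \<beta> \<alpha>] sub[OF a b] sub[OF b a]
    by (metis subset_antisym)
qed


section \<open>Order-preserving maps\<close>

lemma order_preserving_iff:
  "order_preserving \<alpha> \<longleftrightarrow> (\<forall>x y u v. \<alpha> x = Some u \<longrightarrow> \<alpha> y = Some v \<longrightarrow> x \<le> y \<longrightarrow> u \<le> v)"
proof -
  have "order_preserving \<alpha> \<longleftrightarrow> (\<forall>x\<in>dom \<alpha>. \<forall>y\<in>dom \<alpha>. x \<le> y \<longrightarrow> the (\<alpha> x) \<le> the (\<alpha> y))"
    unfolding order_preserving_def order_preserving_on_def mono_on_def by blast
  also have "\<dots> \<longleftrightarrow> (\<forall>x y u v. \<alpha> x = Some u \<longrightarrow> \<alpha> y = Some v \<longrightarrow> x \<le> y \<longrightarrow> u \<le> v)"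
    (is "?L \<longleftrightarrow> ?R")
  proof
    assume L: ?L
    show ?R
    proof (intro allI impI)
      fix x y u v assume xy: "\<alpha> x = Some u" "\<alpha> y = Some v" "x \<le> y"
      then show "u \<le> v" using L[THEN bspec, THEN bspec, of x y] by (simp add: domI)
    qed
  next
    assume R: ?R
    show ?L
    proof (intro ballI impI)
      fix x y assume "x \<in> dom \<alpha>" "y \<in> dom \<alpha>" "x \<le> y"
      then obtain u v where "\<alpha> x = Some u" "\<alpha> y = Some v" by blast
      with \<open>x \<le> y\<close> R show "the (\<alpha> x) \<le> the (\<alpha> y)" by simp
    qed
  qed
  finally show ?thesis .
qed

lemma order_preserving_id: "order_preserving (Some |` X)"
  by (auto simp: order_preserving_iff restrict_map_def split: if_splits)

lemma order_preserving_pcomp: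
  "order_preserving \<alpha> \<Longrightarrow> order_preserving \<beta> \<Longrightarrow> order_preserving (pcomp \<alpha> \<beta>)"
  unfolding order_preserving_iff pcomp_eq_Some_iff by blast

lemma order_preserving_section:
  assumes "is_section \<sigma> \<beta>" "order_preserving \<beta>"
  shows "order_preserving \<sigma>"
  unfolding order_preserving_iff
proof (intro allI impI)
  fix x y u v assume s: "\<sigma> x = Some u" "\<sigma> y = Some v" and "x \<le> y"
  then have b: "\<beta> u = Some x" "\<beta> v = Some y" using assms(1) by (auto simp: is_section_def)
  show "u \<le> v"
  proof (rule ccontr)
    assume "\<not> u \<le> v"
    with b assms(2) have "y \<le> x" by (auto simp: order_preserving_iff)
    with \<open>x \<le> y\<close> s have "u = v" by simp
    with \<open>\<not> u \<le> v\<close> show False by simp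
  qed
qed


section \<open>Orientation-preserving maps\<close>

text \<open>
  The set \<open>Y\<close> of an orientation-preserving map, without the requirements that it be non-empty and
  contained in the domain. Allowing these degenerate cuts makes the empty map an ordinary case and
  saves case distinctions when cuts are constructed.
\<close>

definition is_cut :: "'a::linorder set \<Rightarrow> ('a \<rightharpoonup> 'a) \<Rightarrow> bool" where
  "is_cut Y \<alpha> \<longleftrightarrow> (\<forall>x y u v. \<alpha> x = Some u \<longrightarrow> \<alpha> y = Some v \<longrightarrow>
    ((x \<in> Y \<longleftrightarrow> y \<in> Y) \<longrightarrow> x \<le> y \<longrightarrow> u \<le> v) \<and> (x \<in> Y \<longrightarrow> y \<notin> Y \<longrightarrow> x \<le> y \<and> v \<le> u))"

lemma is_cut_same_side:
  "is_cut Y \<alpha> \<Longrightarrow> \<alpha> x = Some u \<Longrightarrow> \<alpha> y = Some v \<Longrightarrow> (x \<in> Y \<longleftrightarrow> y \<in> Y) \<Longrightarrow> x \<le> y \<Longrightarrow> u \<le> v"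
  unfolding is_cut_def by blast

lemma is_cut_across:
  assumes "is_cut Y \<alpha>" "\<alpha> x = Some u" "\<alpha> y = Some v" "x \<in> Y" "y \<notin> Y"
  shows "x \<le> y" "v \<le> u"
  using assms unfolding is_cut_def by blast+

lemma is_cutI:
  assumes "\<And>x y u v. \<alpha> x = Some u \<Longrightarrow> \<alpha> y = Some v \<Longrightarrow> x \<in> Y \<Longrightarrow> y \<in> Y \<Longrightarrow> x \<le> y \<Longrightarrow> u \<le> v"
    and "\<And>x y u v. \<alpha> x = Some u \<Longrightarrow> \<alpha> y = Some v \<Longrightarrow> x \<notin> Y \<Longrightarrow> y \<notin> Y \<Longrightarrow> x \<le> y \<Longrightarrow> u \<le> v"
    and "\<And>x y u v. \<alpha> x = Some u \<Longrightarrow> \<alpha> y = Some v \<Longrightarrow> x \<in> Y \<Longrightarrow> y \<notin> Y \<Longrightarrow> x \<le> y \<and> v \<le> u"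
  shows "is_cut Y \<alpha>"
  unfolding is_cut_def
proof (intro allI impI conjI)
  fix x y u v assume xy: "\<alpha> x = Some u" "\<alpha> y = Some v"
  show "u \<le> v" if "x \<in> Y \<longleftrightarrow> y \<in> Y" "x \<le> y"
    using assms(1)[OF xy] assms(2)[OF xy] that by argo
  show "x \<le> y" "v \<le> u" if "x \<in> Y" "y \<notin> Y"
    using assms(3)[OF xy that] by simp_all
qed

lemma orientation_preserving_iff_cut: "orientation_preserving \<alpha> \<longleftrightarrow> (\<exists>Y. is_cut Y \<alpha>)"
proof
  assume "orientation_preserving \<alpha>"
  then consider "\<alpha> = Map.empty" | Y where "order_preserving_on Y \<alpha>"
    "order_preserving_on (dom \<alpha> - Y) \<alpha>"
    "\<forall>a\<in>Y. \<forall>b\<in>dom \<alpha> - Y. a \<le> b \<and> the (\<alpha> a) \<ge> the (\<alpha> b)"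
    unfolding orientation_preserving_def by blast
  then show "\<exists>Y. is_cut Y \<alpha>"
  proof cases
    case 1
    then show ?thesis by (simp add: is_cut_def)
  next
    case 2
    have "is_cut Y \<alpha>"
    proof (rule is_cutI)
      fix x y u v assume xy: "\<alpha> x = Some u" "\<alpha> y = Some v"
      then have dom: "x \<in> dom \<alpha>" "y \<in> dom \<alpha>" by auto
      show "u \<le> v" if "x \<in> Y" "y \<in> Y" "x \<le> y"
        using that 2(1) xy mono_onD[of Y "\<lambda>x. the (\<alpha> x)" x y] by (simp add: order_preserving_on_def)
      show "u \<le> v" if "x \<notin> Y" "y \<notin> Y" "x \<le> y"
        using that 2(2) xy dom mono_onD[of "dom \<alpha> - Y" "\<lambda>x. the (\<alpha> x)" x y]
        by (simp add: order_preserving_on_def)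
      show "x \<le> y \<and> v \<le> u" if "x \<in> Y" "y \<notin> Y"
        using 2(3)[THEN bspec[of _ _ x], THEN bspec[of _ _ y]] that xy dom by simp
    qed
    then show ?thesis ..
  qed
next
  assume "\<exists>Y. is_cut Y \<alpha>"
  then obtain Y where Y: "is_cut Y \<alpha>" ..
  show "orientation_preserving \<alpha>"
  proof (cases "\<alpha> = Map.empty")
    case False
    \<comment> \<open>If no point of the domain lies in \<open>Y\<close>, the map is increasing and the whole domain serves.\<close>
    define Z where "Z = (if dom \<alpha> \<inter> Y = {} then dom \<alpha> else dom \<alpha> \<inter> Y)"
    have Z: "Z \<noteq> {}" "Z \<subseteq> dom \<alpha>" using False by (auto simp: Z_def)
    have mem: "(x \<in> Z \<longleftrightarrow> y \<in> Z) \<longleftrightarrow> (x \<in> Y \<longleftrightarrow> y \<in> Y)" if "x \<in> dom \<alpha>" "y \<in> dom \<alpha>" for x y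
      using that by (auto simp: Z_def)
    have across: "x \<in> Y \<and> y \<notin> Y" if "x \<in> Z" "y \<in> dom \<alpha> - Z" for x y
      using that by (auto simp: Z_def split: if_splits)
    have op: "order_preserving_on W \<alpha>"
      if W: "W \<subseteq> dom \<alpha>" "\<And>x y. x \<in> W \<Longrightarrow> y \<in> W \<Longrightarrow> x \<in> Y \<longleftrightarrow> y \<in> Y" for W
      unfolding order_preserving_on_def
    proof (intro conjI mono_onI)
      fix x y assume xy: "x \<in> W" "y \<in> W" "x \<le> y"
      then obtain u v where uv: "\<alpha> x = Some u" "\<alpha> y = Some v" using W(1) by blast
      show "the (\<alpha> x) \<le> the (\<alpha> y)"
        using is_cut_same_side[OF Y uv W(2)[OF xy(1,2)] xy(3)] uv by simp
    qed (rule W(1))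
    have "order_preserving_on Z \<alpha>" "order_preserving_on (dom \<alpha> - Z) \<alpha>"
      using Z(2) mem by (intro op; blast)+
    moreover have "a \<le> b \<and> the (\<alpha> a) \<ge> the (\<alpha> b)" if ab: "a \<in> Z" "b \<in> dom \<alpha> - Z" for a b
    proof -
      obtain u v where uv: "\<alpha> a = Some u" "\<alpha> b = Some v" using ab Z(2) by blast
      have "a \<in> Y" "b \<notin> Y" using across[OF ab] by blast+
      then show ?thesis using is_cut_across[OF Y uv] uv by simp
    qed
    ultimately show ?thesis using Z unfolding orientation_preserving_def by blast
  qed (simp add: orientation_preserving_def)
qed

lemma orientation_preserving_id: "orientation_preserving (Some |` X)"
proof -
  have "is_cut UNIV (Some |` X)"
    by (auto simp: is_cut_def restrict_map_def split: if_splits)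
  then show ?thesis by (auto simp: orientation_preserving_iff_cut)
qed

text \<open>
  Cuts \<open>Y\<close> of \<open>\<alpha>\<close> and \<open>Z\<close> of \<open>\<beta>\<close> divide the domain of \<open>\<alpha>\<beta>\<close> into four consecutive blocks,
  according to membership of \<open>x\<close> in \<open>Y\<close> and then of \<open>x\<alpha>\<close> in \<open>Z\<close>; let \<open>P\<close> be the preimage of
  \<open>Z\<close>. The first block \<open>Y \<inter> P\<close> and the last block, outside \<open>Y \<union> P\<close>, cannot both be inhabited:
  \<open>\<alpha>\<close> would send the first above the last while \<open>Z\<close> lies below its complement. Between the two
  middle blocks both maps reverse the order, so the composite preserves it (\<open>middle\<close>). If only one
  of the two maps has its cut between two points, the composite reverses their order (\<open>split_Z\<close>,
  \<open>split_Y\<close>). Hence one cut remains: before the last block if the first is empty, and otherwise,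
  the last being empty, after the first.
\<close>

lemma orientation_preserving_pcomp:
  assumes "orientation_preserving \<alpha>" "orientation_preserving \<beta>"
  shows "orientation_preserving (pcomp \<alpha> \<beta>)"
proof -
  obtain Y Z where Y: "is_cut Y \<alpha>" and Z: "is_cut Z \<beta>"
    using assms by (auto simp: orientation_preserving_iff_cut)
  define P where "P = {x. \<exists>u\<in>Z. \<alpha> x = Some u}"
  have inP: "x \<in> P \<longleftrightarrow> u \<in> Z" if "\<alpha> x = Some u" for x u
    using that by (simp add: P_def)
  have same_block: "r \<le> s"
    if "\<alpha> x = Some u" "\<beta> u = Some r" "\<alpha> y = Some v" "\<beta> v = Some s"
      "x \<in> Y \<longleftrightarrow> y \<in> Y" "u \<in> Z \<longleftrightarrow> v \<in> Z" "x \<le> y" for x u r y v s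
    using is_cut_same_side[OF Z that(2,4,6) is_cut_same_side[OF Y that(1,3,5,7)]] .
  \<comment> \<open>The inequality is strict in order to exclude that a point of the third block weakly precedes one
     of the second.\<close>
  have middle: "x < y \<and> r \<le> s"
    if "\<alpha> x = Some u" "\<beta> u = Some r" "\<alpha> y = Some v" "\<beta> v = Some s"
      "x \<in> Y" "u \<notin> Z" "y \<notin> Y" "v \<in> Z" for x u r y v s
  proof -
    have "x \<noteq> y" using that(5,7) by blast
    then show ?thesis
      using is_cut_across(1)[OF Y that(1,3,5,7)] is_cut_across(2)[OF Z that(4,2,8,6)] by simp
  qed
  have split_Z: "x \<le> y \<and> s \<le> r"
    if "\<alpha> x = Some u" "\<beta> u = Some r" "\<alpha> y = Some v" "\<beta> v = Some s"
      "x \<in> Y \<longleftrightarrow> y \<in> Y" "u \<in> Z" "v \<notin> Z" for x u r y v s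
  proof -
    have "u < v" using is_cut_across(1)[OF Z that(2,4,6,7)] that(6,7) by (metis order_le_less)
    then have "x \<le> y" using is_cut_same_side[OF Y that(3,1) that(5)[symmetric]] by (metis linear not_le)
    then show ?thesis using is_cut_across(2)[OF Z that(2,4,6,7)] ..
  qed
  have split_Y: "x \<le> y \<and> s \<le> r"
    if "\<alpha> x = Some u" "\<beta> u = Some r" "\<alpha> y = Some v" "\<beta> v = Some s"
      "x \<in> Y" "y \<notin> Y" "u \<in> Z \<longleftrightarrow> v \<in> Z" for x u r y v s
    using is_cut_across[OF Y that(1,3,5,6)] is_cut_same_side[OF Z that(4,2) that(7)[symmetric]] by simp
  have first_or_last: "y \<in> Y \<or> v \<in> Z"
    if "\<alpha> x = Some u" "\<beta> u = Some r" "x \<in> Y" "u \<in> Z" "\<alpha> y = Some v" "\<beta> v = Some s" for x u r y v s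
  proof (rule ccontr)
    assume "\<not> ?thesis"
    then have y: "y \<notin> Y" "v \<notin> Z" by simp_all
    have "v \<le> u" "u \<le> v"
      using is_cut_across(2)[OF Y that(1,5,3) y(1)] is_cut_across(1)[OF Z that(2,6,4) y(2)] .
    with that(4) y(2) show False by simp
  qed
  show ?thesis
  proof (cases "\<exists>x u r. \<alpha> x = Some u \<and> \<beta> u = Some r \<and> x \<in> Y \<and> u \<in> Z")
    case False
    then have no_first: "\<not> (x \<in> Y \<and> u \<in> Z)" if "\<alpha> x = Some u" "\<beta> u = Some r" for x u r
      using that by blast
    have "is_cut (Y \<union> P) (pcomp \<alpha> \<beta>)"
    proof (rule is_cutI)
      fix x y r s assume "pcomp \<alpha> \<beta> x = Some r" "pcomp \<alpha> \<beta> y = Some s"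
      then obtain u v where x: "\<alpha> x = Some u" "\<beta> u = Some r" and y: "\<alpha> y = Some v" "\<beta> v = Some s"
        unfolding pcomp_eq_Some_iff by blast
      note facts = same_block[OF x y] middle[OF x y] middle[OF y x] split_Z[OF x y] split_Y[OF x y]
        no_first[OF x] no_first[OF y] inP[OF x(1)] inP[OF y(1)]
      show "r \<le> s" if "x \<in> Y \<union> P" "y \<in> Y \<union> P" "x \<le> y"
        using that facts by (cases "x \<in> Y"; cases "y \<in> Y"; cases "u \<in> Z"; cases "v \<in> Z"; auto)
      show "r \<le> s" if "x \<notin> Y \<union> P" "y \<notin> Y \<union> P" "x \<le> y"
        using that facts by (cases "x \<in> Y"; cases "y \<in> Y"; cases "u \<in> Z"; cases "v \<in> Z"; auto)
      show "x \<le> y \<and> s \<le> r" if "x \<in> Y \<union> P" "y \<notin> Y \<union> P"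
        using that facts by (cases "x \<in> Y"; cases "y \<in> Y"; cases "u \<in> Z"; cases "v \<in> Z"; auto)
    qed
    then show ?thesis unfolding orientation_preserving_iff_cut ..
  next
    case True
    then have no_last: "x \<in> Y \<or> u \<in> Z" if "\<alpha> x = Some u" "\<beta> u = Some r" for x u r
      using that first_or_last by blast
    have "is_cut (Y \<inter> P) (pcomp \<alpha> \<beta>)"
    proof (rule is_cutI)
      fix x y r s assume "pcomp \<alpha> \<beta> x = Some r" "pcomp \<alpha> \<beta> y = Some s"
      then obtain u v where x: "\<alpha> x = Some u" "\<beta> u = Some r" and y: "\<alpha> y = Some v" "\<beta> v = Some s"
        unfolding pcomp_eq_Some_iff by blast
      note facts = same_block[OF x y] middle[OF x y] middle[OF y x] split_Z[OF x y] split_Y[OF x y]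
        no_last[OF x] no_last[OF y] inP[OF x(1)] inP[OF y(1)]
      show "r \<le> s" if "x \<in> Y \<inter> P" "y \<in> Y \<inter> P" "x \<le> y"
        using that facts by (cases "x \<in> Y"; cases "y \<in> Y"; cases "u \<in> Z"; cases "v \<in> Z"; auto)
      show "r \<le> s" if "x \<notin> Y \<inter> P" "y \<notin> Y \<inter> P" "x \<le> y"
        using that facts by (cases "x \<in> Y"; cases "y \<in> Y"; cases "u \<in> Z"; cases "v \<in> Z"; auto)
      show "x \<le> y \<and> s \<le> r" if "x \<in> Y \<inter> P" "y \<notin> Y \<inter> P"
        using that facts by (cases "x \<in> Y"; cases "y \<in> Y"; cases "u \<in> Z"; cases "v \<in> Z"; auto)
    qed
    then show ?thesis unfolding orientation_preserving_iff_cut ..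
  qed
qed

text \<open>
  A map with cut \<open>Y\<close> takes its smaller values outside \<open>Y\<close>. Hence the values whose chosen preimage
  lies outside \<open>Y\<close> form the lower part of the domain of the section, and there the section takes
  its larger values. On each part the section inherits monotonicity as the inverse of an
  increasing map.
\<close>

lemma orientation_preserving_section:
  assumes sec: "is_section \<sigma> \<beta>" and "orientation_preserving \<beta>"
  shows "orientation_preserving \<sigma>"
proof -
  obtain Y where Y: "is_cut Y \<beta>" using assms by (auto simp: orientation_preserving_iff_cut)
  define Z where "Z = {y. \<exists>x. \<sigma> y = Some x \<and> x \<notin> Y}"
  have inZ: "y \<in> Z \<longleftrightarrow> x \<notin> Y" if "\<sigma> y = Some x" for x y
    using that by (simp add: Z_def)
  have val: "\<beta> x = Some y" if "\<sigma> y = Some x" for x y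
    using sec that by (simp add: is_section_def)
  have "is_cut Z \<sigma>"
    unfolding is_cut_def
  proof (intro allI impI conjI)
    fix x y u v assume s: "\<sigma> x = Some u" "\<sigma> y = Some v"
    {
      assume "(x \<in> Z) = (y \<in> Z)" and "x \<le> y"
      then have side: "(v \<in> Y) = (u \<in> Y)" using inZ s by blast
      show "u \<le> v"
      proof (rule ccontr)
        assume "\<not> u \<le> v"
        with is_cut_same_side[OF Y val[OF s(2)] val[OF s(1)] side] have "y \<le> x" by simp
        with \<open>x \<le> y\<close> s have "u = v" by simp
        with \<open>\<not> u \<le> v\<close> show False by simp
      qed
    next
      assume "x \<in> Z" "y \<notin> Z"
      then have "v \<in> Y" "u \<notin> Y" using inZ s by blast+
      then show "x \<le> y" "v \<le> u" using is_cut_across[OF Y val[OF s(2)] val[OF s(1)]] by auto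
    }
  qed
  then show ?thesis by (auto simp: orientation_preserving_iff_cut)
qed


section \<open>The four monoids\<close>

lemma injective_iff: "injective \<alpha> \<longleftrightarrow> (\<forall>x y u. \<alpha> x = Some u \<longrightarrow> \<alpha> y = Some u \<longrightarrow> x = y)"
  by (force simp: injective_def inj_on_def dom_def)

lemma injective_id: "injective (Some |` X)"
  by (auto simp: injective_iff restrict_map_def split: if_splits)

lemma injective_pcomp: "injective \<alpha> \<Longrightarrow> injective \<beta> \<Longrightarrow> injective (pcomp \<alpha> \<beta>)"
  unfolding injective_iff pcomp_eq_Some_iff by blast

lemma has_sections_PT: "has_sections X (PT X)"
  unfolding has_sections_def
proof (intro conjI ballI allI impI)
  show "pcomp \<alpha> \<beta> \<in> carrier (PT X)" if "\<alpha> \<in> carrier (PT X)" "\<beta> \<in> carrier (PT X)" for \<alpha> \<beta>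
    using that order_trans[OF dom_pcomp_subset[of \<alpha> \<beta>]] order_trans[OF ran_pcomp_subset[of \<alpha> \<beta>]]
    by (simp add: PT_def)
  show "Some |` X \<in> carrier (PT X)"
    by (auto simp: PT_def restrict_map_def ran_def split: if_splits)
  show "\<sigma> \<in> carrier (PT X)" if "\<beta> \<in> carrier (PT X)" "is_section \<sigma> \<beta>" for \<beta> \<sigma>
    using section_in_PT that by blast
qed (simp_all add: PT_def)

lemma has_sections_restrict:
  assumes "has_sections X S" "p (Some |` X)"
    and "\<And>\<alpha> \<beta>. p \<alpha> \<Longrightarrow> p \<beta> \<Longrightarrow> p (pcomp \<alpha> \<beta>)"
    and "\<And>\<sigma> \<beta>. is_section \<sigma> \<beta> \<Longrightarrow> p \<beta> \<Longrightarrow> p \<sigma>"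
  shows "has_sections X (S\<lparr>carrier := {\<alpha> \<in> carrier S. p \<alpha>}\<rparr>)"
  using assms unfolding has_sections_def by auto

lemma has_sections_PO: "has_sections X (PO X)"
  unfolding PO_def
  by (intro has_sections_restrict has_sections_PT order_preserving_id)
    (auto intro: order_preserving_pcomp order_preserving_section)

lemma has_sections_POP: "has_sections X (POP X)"
  unfolding POP_def
  by (intro has_sections_restrict has_sections_PT orientation_preserving_id)
    (auto intro: orientation_preserving_pcomp orientation_preserving_section)

lemma has_sections_POI: "has_sections X (POI X)"
  unfolding POI_def
  by (intro has_sections_restrict has_sections_PO injective_id)
    (auto intro: injective_pcomp injective_section)

lemma has_sections_POPI: "has_sections X (POPI X)"
  unfolding POPI_def
  by (intro has_sections_restrict has_sections_POP injective_id)
    (auto intro: injective_pcomp injective_section)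

theorem proposition4p9:
  fixes X :: "'a::linorder set" and S :: "('a \<rightharpoonup> 'a) monoid" and \<alpha> \<beta> :: "'a \<rightharpoonup> 'a"
  assumes "S \<in> {PO X, POP X, POI X, POPI X}"
    and "\<alpha> \<in> carrier S" and "\<beta> \<in> carrier S"
  shows "((\<alpha>, \<beta>) \<in> green_L S \<longleftrightarrow> ran \<alpha> = ran \<beta>) \<and>
    ((\<alpha>, \<beta>) \<in> green_R S \<longleftrightarrow> ker \<alpha> = ker \<beta>) \<and>
    ((\<alpha>, \<beta>) \<in> green_H S \<longleftrightarrow> ran \<alpha> = ran \<beta> \<and> ker \<alpha> = ker \<beta>)"
proof -
  have "has_sections X S"
    using assms(1) has_sections_PO has_sections_POP has_sections_POI has_sections_POPI by blast
  then show ?thesis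
    using assms(2,3) green_L_iff_ran_eq green_R_iff_ker_eq unfolding green_H_def by blast
qed

end
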